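(* For all $K\in\mathcal{K}^d$ and all $P\in\Pi^\flat_{\boldsymbol{a}}(K)$ we have \[\operatorname{dist}(P,K)=0\quad\text{and}\quad \operatorname{dist}(K,P)\le 2\,\delta_{\boldsymbol{a}}\,\|K\|.\]
   Context: Let $d\ge 2$, let $N\in\mathbb{N}$ with $N>1$, and let $a_1,\ldots,a_N\in\mathbb{R}^d$ be pairwise distinct with Euclidean norm $\|a_i\|=1$ for all $i$; write $\boldsymbol{a}=(a_1,\ldots,a_N)\in\mathbb{R}^{d\times N}$. $\mathcal{K}^d$ is the space of all nonempty, convex and compact subsets of $\mathbb{R}^d$. For nonempty compact $K,L\subset\mathbb{R}^d$, $\operatorname{dist}(K,L):=\sup_{x\in K}\inf_{y\in L}\|x-y\|$ (Hausdorff semi-distance) and $\|K\|:=\max_{x\in K}\|x\|$. The (multivalued) projectors are \[\pi^\flat_{\boldsymbol{a}}(K):=\{\boldsymbol{x}=(x_1,\ldots,x_N)\in\mathbb{R}^{d\times N}: x_i\in\operatorname{argmax}_{x\in K}a_i^Tx\ \text{for all}\ i\},\] \[\Pi^\flat_{\boldsymbol{a}}(K):=\{\operatorname{conv}\{x_1,\ldots,x_N\}:\boldsymbol{x}\in\pi^\flat_{\boldsymbol{a}}(K)\}.\] The chordal covering radius is $\delta_{\boldsymbol{a}}:=\max_{u\in S^{d-1}}\min_{i\in\{1,\ldots,N\}}\|u-a_i\|$, where $S^{d-1}$ is the Euclidean unit sphere. *)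

theory Defs
  imports "HOL-Analysis.Analysis"
begin

text \<open>
  Vectors of \<open>\<real>\<^sup>d\<close> have type \<open>real^'d\<close>; an \<open>N\<close>-tuple of such vectors, i.e. an element of
  \<open>\<real>\<^bsup>d \<times> N\<^esup>\<close>, has type \<open>real^'d^'N\<close>, and \<open>a $ i\<close> is its \<open>i\<close>-th member (column).
\<close>

definition convex_bodies :: "(real^'d) set set" where
  "convex_bodies = {K. K \<noteq> {} \<and> convex K \<and> compact K}"

text \<open>The Hausdorff semi-distance, meaningful for nonempty compact (more generally, nonempty
  bounded) arguments, where the real-valued supremum and infimum are proper.\<close>

definition semidist :: "(real^'d) set \<Rightarrow> (real^'d) set \<Rightarrow> real" where
  "semidist K L = (SUP x\<in>K. INF y\<in>L. norm (x - y))"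

text \<open>In the next definition (for nonempty compact \<open>K\<close>) and in \<open>covering_radius\<close>, the supremum is
  that of a continuous function over a nonempty compact set, hence a maximum.\<close>

definition set_norm :: "(real^'d) set \<Rightarrow> real" where
  "set_norm K = (SUP x\<in>K. norm x)"

definition proj_points :: "real^'d^'N \<Rightarrow> (real^'d) set \<Rightarrow> (real^'d^'N) set" where
  "proj_points a K = {x. \<forall>i. is_arg_max (\<lambda>y. a $ i \<bullet> y) (\<lambda>y. y \<in> K) (x $ i)}"

definition proj_hulls :: "real^'d^'N \<Rightarrow> (real^'d) set \<Rightarrow> (real^'d) set set" where
  "proj_hulls a K = {convex hull (range (\<lambda>i. x $ i)) | x. x \<in> proj_points a K}"

definition covering_radius :: "real^'d^'N \<Rightarrow> real" where
  "covering_radius a = (SUP u\<in>sphere 0 1. MIN i. norm (u - a $ i))"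

end

theory Submission
  imports Defs
begin

text \<open>
  Let \<open>p\<close> be the point of \<open>P\<close> closest to \<open>x \<in> K\<close> and \<open>u\<close> the unit vector in direction
  \<open>x - p\<close>, which is an outer normal of \<open>P\<close> at \<open>p\<close>. Choose \<open>a\<^sub>i\<close> within the covering radius
  of \<open>u\<close>, and let \<open>x\<^sub>i \<in> P\<close> maximise \<open>a\<^sub>i\<close> over \<open>K\<close>. Then
  \<open>\<parallel>x - p\<parallel> = u \<bullet> (x - p) \<le> u \<bullet> (x - x\<^sub>i) \<le> (u - a\<^sub>i) \<bullet> (x - x\<^sub>i)\<close>, and Cauchy--Schwarz
  gives the claim.
\<close>

text \<open>The distance to the nearest column is bounded on the sphere, by the triangle inequality,
  so its value at \<open>u\<close> lies below the supremum. The index type is finite, so some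
  \<open>i\<close> attains the minimum.\<close>

lemma covering_radius_attained:
  fixes a :: "real^'d^'N"
  assumes "norm u = 1"
  obtains i where "norm (u - a $ i) \<le> covering_radius a"
proof -
  have "bdd_above ((\<lambda>u. MIN i. norm (u - a $ i)) ` sphere 0 1)"
  proof (rule bdd_aboveI2)
    fix v :: "real^'d" and j :: 'N
    assume "v \<in> sphere 0 1"
    then have "norm (v - a $ j) \<le> 1 + norm (a $ j)"
      using norm_triangle_ineq4[of v "a $ j"] by simp
    moreover have "(MIN i. norm (v - a $ i)) \<le> norm (v - a $ j)"
      by (rule Min_le) auto
    ultimately show "(MIN i. norm (v - a $ i)) \<le> 1 + norm (a $ j)"
      by linarith
  qed
  then have "(MIN i. norm (u - a $ i)) \<le> covering_radius a"
    unfolding covering_radius_def using assms by (intro cSUP_upper) auto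
  moreover have "(MIN i. norm (u - a $ i)) \<in> range (\<lambda>i. norm (u - a $ i))"
    by (rule Min_in) auto
  ultimately show thesis using that by fastforce
qed

lemma norm_le_set_norm:
  assumes "compact K" "x \<in> K"
  shows "norm x \<le> set_norm K"
  unfolding set_norm_def
proof (rule cSUP_upper[OF assms(2)])
  show "bdd_above (norm ` K)"
    using compact_imp_bounded[OF assms(1)] by (auto simp: bounded_iff intro: bdd_aboveI2)
qed

lemma INF_norm_diff_le:
  fixes x :: "'a::real_normed_vector"
  assumes "y \<in> L"
  shows "(INF y\<in>L. norm (x - y)) \<le> norm (x - y)"
  using assms by (intro cINF_lower bdd_belowI2[where m = 0]) auto

lemma semidist_eq_0_if_subset:
  assumes "P \<subseteq> K" "P \<noteq> {}"
  shows "semidist P K = 0"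
proof -
  have "(INF y\<in>K. norm (x - y)) = 0" if "x \<in> P" for x
  proof (rule antisym)
    show "(INF y\<in>K. norm (x - y)) \<le> 0"
      using INF_norm_diff_le[of x K x] that assms by auto
    show "0 \<le> (INF y\<in>K. norm (x - y))"
      using assms by (intro cINF_greatest) auto
  qed
  \<comment> \<open>Since \<open>P\<close> is nonempty, the supremum of the constant 0 over it is
    0.\<close>
  then show ?thesis
    unfolding semidist_def using assms by (simp cong: SUP_cong)
qed

theorem theorem34:
  fixes a :: "real^'d^'N" and K P :: "(real^'d) set"
  assumes "CARD('d) \<ge> 2" and "CARD('N) > 1"
    and "\<And>i j. i \<noteq> j \<Longrightarrow> a $ i \<noteq> a $ j"
    and "\<And>i. norm (a $ i) = 1"
    and "K \<in> convex_bodies"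
    and "P \<in> proj_hulls a K"
  shows "semidist P K = 0 \<and> semidist K P \<le> 2 * covering_radius a * set_norm K"
proof
  have K: "K \<noteq> {}" "convex K" "compact K"
    using assms(5) by (auto simp: convex_bodies_def)
  obtain X :: "real^'d^'N" where P_eq: "P = convex hull (range (\<lambda>i. X $ i))"
    and X: "X \<in> proj_points a K"
    using assms(6) by (auto simp: proj_hulls_def)
  have X_in: "X $ i \<in> K" and X_max: "y \<in> K \<Longrightarrow> a $ i \<bullet> y \<le> a $ i \<bullet> X $ i" for i y
    using X by (auto simp: proj_points_def is_arg_max_linorder)
  have X_P: "X $ i \<in> P" for i
    unfolding P_eq by (rule hull_inc) auto
  then have P_ne: "P \<noteq> {}" by blast
  have P: "convex P" "closed P"
    unfolding P_eq by (auto intro!: compact_imp_closed finite_imp_compact_convex_hull)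
  have "P \<subseteq> K"
    unfolding P_eq using K X_in by (intro hull_minimal) auto
  then show "semidist P K = 0" using P_ne by (rule semidist_eq_0_if_subset)
  show "semidist K P \<le> 2 * covering_radius a * set_norm K"
    unfolding semidist_def
  proof (rule cSUP_least[OF K(1)])
    fix x assume x: "x \<in> K"
    define p where "p = closest_point P x"
    have "p \<in> P" using P P_ne unfolding p_def by (intro closest_point_in_set)
    obtain u where u: "norm u = 1" "x - p = norm (x - p) *\<^sub>R u"
    proof (cases "x = p")
      case True
      \<comment> \<open>Any unit vector serves when \<open>x - p = 0\<close>; a column of
        \<open>a\<close> is at hand.\<close>
      then show thesis using that assms(4) by auto
    next
      case False
      then show thesis using that[of "sgn (x - p)"] by (simp add: norm_sgn sgn_div_norm)
    qed
    then have ux: "u \<bullet> (x - p) = norm (x - p)"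
      by (metis inner_scaleR_right mult.right_neutral norm_eq_1)
    obtain i where i: "norm (u - a $ i) \<le> covering_radius a"
      using covering_radius_attained[OF u(1)] .
    \<comment> \<open>Both points lie in \<open>K\<close>; this is the source of the factor
      2.\<close>
    have diam: "norm (x - X $ i) \<le> 2 * set_norm K"
      using norm_triangle_ineq4[of x "X $ i"] norm_le_set_norm[OF K(3) x]
        norm_le_set_norm[OF K(3) X_in[of i]]
      by linarith
    have "norm (x - p) \<le> 2 * covering_radius a * set_norm K"
    proof (cases "x = p")
      case True
      have "0 \<le> covering_radius a" using i norm_ge_zero order_trans by blast
      moreover have "0 \<le> set_norm K"
        using norm_le_set_norm[OF K(3) x] norm_ge_zero order_trans by blast
      ultimately show ?thesis using True by simp
    next
      case False
      \<comment> \<open>Scaling by \<open>norm (x - p)\<close>, positive here, reduces the sign of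
        \<open>u \<bullet> (X $ i - p)\<close> to the obtuse-angle property of the closest point of
        a closed convex set.\<close>
      have "norm (x - p) * (u \<bullet> (X $ i - p)) = (x - p) \<bullet> (X $ i - p)"
        by (metis u(2) inner_scaleR_left)
      also have "\<dots> \<le> 0"
        unfolding p_def using P X_P by (rule closest_point_dot)
      finally have normal: "u \<bullet> (X $ i - p) \<le> 0"
        using False by (simp add: mult_le_0_iff)
      have "norm (x - p) = u \<bullet> (x - X $ i) + u \<bullet> (X $ i - p)"
        using ux by (simp add: inner_diff_right)
      \<comment> \<open>The normal term is dropped, and \<open>a $ i \<bullet> (x - X $ i)\<close>,
        nonpositive because \<open>X $ i\<close> maximises \<open>a $ i\<close> over
        \<open>K\<close>, is subtracted.\<close>
      also have "\<dots> \<le> (u - a $ i) \<bullet> (x - X $ i)"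
        using normal X_max[OF x, of i] by (simp add: inner_diff_left inner_diff_right)
      also have "\<dots> \<le> norm (u - a $ i) * norm (x - X $ i)"
        by (rule norm_cauchy_schwarz)
      also have "\<dots> \<le> covering_radius a * (2 * set_norm K)"
        using i diam by (intro mult_mono) (auto intro: order_trans[OF norm_ge_zero])
      finally show ?thesis by (simp add: mult_ac)
    qed
    then show "(INF y\<in>P. norm (x - y)) \<le> 2 * covering_radius a * set_norm K"
      using INF_norm_diff_le[OF \<open>p \<in> P\<close>, of x] by linarith
  qed
qed

end
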